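(* Let $(V_k,V_k^+,e_k)_{k\in\mathbb{N}}$ be ordered $*$-vector spaces with order units and let $\phi_k:V_k\to V_{k+1}$ be unital positive linear maps, so that $V_1\xrightarrow{\phi_1}V_2\xrightarrow{\phi_2}V_3\xrightarrow{\phi_3}\cdots$ is an inductive system in the category $\mathbf{OU}$. Let $(\ddot V_\infty,\ddot V_\infty^+,\ddot e_\infty)$ and the maps $\ddot\phi_{k,\infty}:V_k\to\ddot V_\infty$, $k\in\mathbb{N}$, be as constructed in the context. Then $(\ddot V_\infty,\ddot V_\infty^+,\ddot e_\infty)$, together with $\{\ddot\phi_{k,\infty}\}_{k\in\mathbb{N}}$, is an inductive limit of this inductive system in $\mathbf{OU}$.
   Context: A $*$-vector space is a complex vector space $V$ with a conjugate-linear involution $*$; $V_h=\{x\in V:x^*=x\}$. An ordered $*$-vector space is a pair $(V,V^+)$ where $V^+\subseteq V_h$ is a cone (closed under addition and multiplication by non-negative scalars) with $V^+\cap(-V^+)=\{0\}$; $x\le y$ means $y-x\in V^+$. An order unit is $e\in V^+$ such that for every $x\in V_h$ there is $r>0$ with $x\le re$. A linear map $\phi:V\to W$ is positive if $\phi(V^+)\subseteq W^+$ and unital if $\phi(e_V)=e_W$. $\mathbf{OU}$ is the category whose objects are ordered $*$-vector spaces with order units and whose morphisms are unital positive linear maps. Inductive limit (in a category $\mathbf{C}$): for an inductive system $(\{A_k\},\{\alpha_k:A_k\to A_{k+1}\})_{k\in\mathbb{N}}$, it is an object $A$ with morphisms $\alpha_{k,\infty}:A_k\to A$ such that (1) $\alpha_{k+1,\infty}\circ\alpha_k=\alpha_{k,\infty}$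 for all $k$, and (2) whenever $B$ is an object and $\beta_k:A_k\to B$ are morphisms with $\beta_{k+1}\circ\alpha_k=\beta_k$ for all $k$, there is a unique morphism $\mu:A\to B$ with $\mu\circ\alpha_{k,\infty}=\beta_k$ for all $k$. Construction. For $k<l$ put $\phi_{k,l}=\phi_{l-1}\circ\cdots\circ\phi_k$, and $\phi_{k,k}=\mathrm{id}$. Let $V_\infty^0=\{(x_k)_k\in\prod_k V_k:\exists m \text{ such that } \phi_k(x_k)=x_{k+1}\ \forall k\ge m\}$, $N^0=\{(x_k)_k\in V_\infty^0:\exists m \text{ such that } x_k=0\ \forall k\ge m\}$, and $\ddot V_\infty=V_\infty^0/N^0$ (vector space quotient). Let $\ddot\phi_{k,\infty}(x)$ be the class of the sequence $(y_i)_i$ with $y_i=0$ for $i<k$ and $y_i=\phi_{k,i}(x)$ for $i\ge k$. Then $\ddot V_\infty=\bigcup_k\ddot\phi_{k,\infty}(V_k)$. The involution is $\ddot\phi_{k,\infty}(x_k)^*=\ddot\phi_{k,\infty}(x_k^* )$; the cone is $\ddot V_\infty^+=\{\ddot\phi_{k,\infty}(x_k):k\in\mathbb{N},\ x_k\in V_k,\ \exists m\ge k \text{ with } \phi_{k,m}(x_k)\in V_m^+\}$; and $\ddot e_\infty=\ddot\phi_{k,\infty}(e_k)$ (independent of $k$). *)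

theory Defs
  imports Complex_Main "HOL-Algebra.Algebraic_Closure_Type"
begin

text \<open>
  Complex vector spaces are modules, in the sense of HOL-Algebra, over
  \<^term>\<open>ring_of_type_algebra :: complex ring\<close>, the field of all complex numbers. As for every
  HOL-Algebra module, the fields \<open>mult\<close> and \<open>one\<close> of the record are irrelevant.
\<close>

record 'a ou_space = "(complex, 'a) module" +
  star :: "'a \<Rightarrow> 'a"
  pos_cone :: "'a set"
  order_unit :: 'a

locale star_vector_space =
  module "ring_of_type_algebra :: complex ring" V for V :: "'a ou_space" (structure) +
  assumes star_closed: "x \<in> carrier V \<Longrightarrow> star V x \<in> carrier V"
    and star_star: "x \<in> carrier V \<Longrightarrow> star V (star V x) = x"
    and star_add: "\<lbrakk>x \<in> carrier V; y \<in> carrier V\<rbrakk> \<Longrightarrow> star V (x \<oplus> y) = star V x \<oplus> star V y"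
    and star_smult: "x \<in> carrier V \<Longrightarrow> star V (c \<odot>\<^bsub>V\<^esub> x) = cnj c \<odot>\<^bsub>V\<^esub> star V x"

definition hermitian :: "'a ou_space \<Rightarrow> 'a set" where
  "hermitian V = {x \<in> carrier V. star V x = x}"

definition ou_le :: "'a ou_space \<Rightarrow> 'a \<Rightarrow> 'a \<Rightarrow> bool" where
  "ou_le V x y \<longleftrightarrow> y \<ominus>\<^bsub>V\<^esub> x \<in> pos_cone V"

locale ordered_star_vector_space = star_vector_space +
  assumes pos_cone_hermitian: "pos_cone V \<subseteq> hermitian V"
    and pos_cone_add: "\<lbrakk>x \<in> pos_cone V; y \<in> pos_cone V\<rbrakk> \<Longrightarrow> x \<oplus> y \<in> pos_cone V"
    and pos_cone_smult:
      "\<lbrakk>(r::real) \<ge> 0; x \<in> pos_cone V\<rbrakk> \<Longrightarrow> complex_of_real r \<odot>\<^bsub>V\<^esub> x \<in> pos_cone V"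
    and pos_cone_proper: "pos_cone V \<inter> (\<lambda>x. \<ominus> x) ` pos_cone V = {\<zero>}"

locale ou_object = ordered_star_vector_space +
  assumes order_unit_pos: "order_unit V \<in> pos_cone V"
    and order_unit_dominates:
      "x \<in> hermitian V \<Longrightarrow> \<exists>r>0. ou_le V x (complex_of_real r \<odot>\<^bsub>V\<^esub> order_unit V)"

definition linear_maps :: "'a ou_space \<Rightarrow> 'b ou_space \<Rightarrow> ('a \<Rightarrow> 'b) set" where
  "linear_maps V W =
    {f \<in> hom (add_monoid V) (add_monoid W).
      \<forall>c. \<forall>x \<in> carrier V. f (c \<odot>\<^bsub>V\<^esub> x) = c \<odot>\<^bsub>W\<^esub> f x}"

definition ou_hom :: "'a ou_space \<Rightarrow> 'b ou_space \<Rightarrow> ('a \<Rightarrow> 'b) set" where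
  "ou_hom V W =
    {f \<in> linear_maps V W. f ` pos_cone V \<subseteq> pos_cone W \<and> f (order_unit V) = order_unit W}"

definition ou_inductive_system :: "(nat \<Rightarrow> 'a ou_space) \<Rightarrow> (nat \<Rightarrow> 'a \<Rightarrow> 'a) \<Rightarrow> bool" where
  "ou_inductive_system V \<phi> \<longleftrightarrow>
    (\<forall>k. ou_object (V k)) \<and> (\<forall>k. \<phi> k \<in> ou_hom (V k) (V (Suc k)))"

text \<open>
  The type argument fixes the type in which the carriers of the test objects \<open>B\<close> of the universal
  property live. Morphisms are determined by their values on the carrier only, hence the mediating
  morphism is unique among the functions that are extensional on the carrier of \<open>A\<close>.
\<close>

definition ou_inductive_limit ::
  "'c itself \<Rightarrow> (nat \<Rightarrow> 'a ou_space) \<Rightarrow> (nat \<Rightarrow> 'a \<Rightarrow> 'a) \<Rightarrow>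
    'b ou_space \<Rightarrow> (nat \<Rightarrow> 'a \<Rightarrow> 'b) \<Rightarrow> bool" where
  "ou_inductive_limit (T :: 'c itself) V \<phi> A \<alpha> \<longleftrightarrow>
    ou_object A \<and>
    (\<forall>k. \<alpha> k \<in> ou_hom (V k) A) \<and>
    (\<forall>k. \<forall>x \<in> carrier (V k). \<alpha> (Suc k) (\<phi> k x) = \<alpha> k x) \<and>
    (\<forall>(B :: 'c ou_space) \<beta>.
      ou_object B \<longrightarrow>
      (\<forall>k. \<beta> k \<in> ou_hom (V k) B) \<longrightarrow>
      (\<forall>k. \<forall>x \<in> carrier (V k). \<beta> (Suc k) (\<phi> k x) = \<beta> k x) \<longrightarrow>
      (\<exists>!\<mu>. \<mu> \<in> ou_hom A B \<and> \<mu> \<in> extensional (carrier A) \<and>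
        (\<forall>k. \<forall>x \<in> carrier (V k). \<mu> (\<alpha> k x) = \<beta> k x)))"

text \<open>
  For \<open>k < l\<close> this is \<open>\<phi> (l - 1) \<circ> \<dots> \<circ> \<phi> k\<close>; for \<open>k = l\<close> it is the identity.
\<close>

definition connecting :: "(nat \<Rightarrow> 'a \<Rightarrow> 'a) \<Rightarrow> nat \<Rightarrow> nat \<Rightarrow> 'a \<Rightarrow> 'a" where
  "connecting \<phi> k l = fold \<phi> [k..<l]"

definition coherent_seqs ::
  "(nat \<Rightarrow> 'a ou_space) \<Rightarrow> (nat \<Rightarrow> 'a \<Rightarrow> 'a) \<Rightarrow> (complex, nat \<Rightarrow> 'a) module" where
  "coherent_seqs V \<phi> =
    \<lparr>carrier = {x. (\<forall>k. x k \<in> carrier (V k)) \<and> (\<exists>m. \<forall>k\<ge>m. \<phi> k (x k) = x (Suc k))},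
     monoid.mult = undefined, one = undefined,
     ring.zero = (\<lambda>k. \<zero>\<^bsub>V k\<^esub>), add = (\<lambda>x y k. x k \<oplus>\<^bsub>V k\<^esub> y k),
     module.smult = (\<lambda>c x k. c \<odot>\<^bsub>V k\<^esub> x k)\<rparr>"

definition null_seqs :: "(nat \<Rightarrow> 'a ou_space) \<Rightarrow> (nat \<Rightarrow> 'a \<Rightarrow> 'a) \<Rightarrow> (nat \<Rightarrow> 'a) set" where
  "null_seqs V \<phi> = {x \<in> carrier (coherent_seqs V \<phi>). \<exists>m. \<forall>k\<ge>m. x k = \<zero>\<^bsub>V k\<^esub>}"

definition limit_map ::
  "(nat \<Rightarrow> 'a ou_space) \<Rightarrow> (nat \<Rightarrow> 'a \<Rightarrow> 'a) \<Rightarrow> nat \<Rightarrow> 'a \<Rightarrow> (nat \<Rightarrow> 'a) set" where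
  "limit_map V \<phi> k x =
    null_seqs V \<phi> +>\<^bsub>coherent_seqs V \<phi>\<^esub>
      (\<lambda>i. if i < k then \<zero>\<^bsub>V i\<^esub> else connecting \<phi> k i x)"

text \<open>
  Scalar multiplication is written as a union over representatives, in the style of
  \<^const>\<open>rcoset_mult\<close>. The definite description in the involution is well defined because
  the connecting morphisms of an inductive system preserve \<open>star\<close>.
\<close>

definition limit_space ::
  "(nat \<Rightarrow> 'a ou_space) \<Rightarrow> (nat \<Rightarrow> 'a \<Rightarrow> 'a) \<Rightarrow> (nat \<Rightarrow> 'a) set ou_space" where
  "limit_space V \<phi> =
    \<lparr>carrier = a_rcosets\<^bsub>coherent_seqs V \<phi>\<^esub> (null_seqs V \<phi>),
     monoid.mult = undefined, one = undefined,
     ring.zero = null_seqs V \<phi>,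
     add = set_add (coherent_seqs V \<phi>),
     module.smult = (\<lambda>c S. \<Union>x\<in>S. null_seqs V \<phi> +>\<^bsub>coherent_seqs V \<phi>\<^esub> (c \<odot>\<^bsub>coherent_seqs V \<phi>\<^esub> x)),
     star = (\<lambda>S. THE S'. \<exists>k. \<exists>x \<in> carrier (V k).
       S = limit_map V \<phi> k x \<and> S' = limit_map V \<phi> k (star (V k) x)),
     pos_cone = {limit_map V \<phi> k x | k x.
       x \<in> carrier (V k) \<and> (\<exists>m\<ge>k. connecting \<phi> k m x \<in> pos_cone (V m))},
     order_unit = limit_map V \<phi> 0 (order_unit (V 0))\<rparr>"

end

theory Submission
  imports Defs
begin

text \<open>
  Every element of the limit has the form \<open>L k x\<close>, finitely many elements can be represented at a
  common level \<open>k\<close>, and \<open>L k x = L l y\<close> holds exactly when the images of \<open>x\<close> and \<open>y\<close> at some later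
  level agree. Each axiom for the limit thus reduces to the same axiom at a finite level. The
  involution is well defined because unital positive maps between objects commute with \<open>star\<close>:
  the order unit makes every hermitian element a difference of positive ones, so hermitian
  elements go to hermitian elements, and every element is \<open>a + \<i> b\<close> with \<open>a\<close>, \<open>b\<close> hermitian.
  The mediating morphism is forced to be \<open>L k x \<mapsto> \<beta> k x\<close>.
\<close>

section \<open>Complex scalars and morphisms of OU\<close>

lemma ring_of_type_algebra_simps [simp]:
  "carrier ring_of_type_algebra = UNIV"
  "monoid.mult ring_of_type_algebra = (*)"
  "monoid.one ring_of_type_algebra = 1"
  "ring.add ring_of_type_algebra = (+)"
  "ring.zero ring_of_type_algebra = 0"
  by (simp_all add: ring_of_type_algebra_def)

lemma ou_homI:
  assumes "\<And>x. x \<in> carrier V \<Longrightarrow> f x \<in> carrier W"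
    and "\<And>x y. x \<in> carrier V \<Longrightarrow> y \<in> carrier V \<Longrightarrow> f (x \<oplus>\<^bsub>V\<^esub> y) = f x \<oplus>\<^bsub>W\<^esub> f y"
    and "\<And>c x. x \<in> carrier V \<Longrightarrow> f (c \<odot>\<^bsub>V\<^esub> x) = c \<odot>\<^bsub>W\<^esub> f x"
    and "\<And>x. x \<in> pos_cone V \<Longrightarrow> f x \<in> pos_cone W"
    and "f (order_unit V) = order_unit W"
  shows "f \<in> ou_hom V W"
  using assms by (auto simp: ou_hom_def linear_maps_def hom_def)

lemma ou_homD:
  assumes "f \<in> ou_hom V W"
  shows ou_hom_closed: "x \<in> carrier V \<Longrightarrow> f x \<in> carrier W"
    and ou_hom_add: "\<lbrakk>x \<in> carrier V; y \<in> carrier V\<rbrakk> \<Longrightarrow> f (x \<oplus>\<^bsub>V\<^esub> y) = f x \<oplus>\<^bsub>W\<^esub> f y"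
    and ou_hom_smult: "x \<in> carrier V \<Longrightarrow> f (c \<odot>\<^bsub>V\<^esub> x) = c \<odot>\<^bsub>W\<^esub> f x"
    and ou_hom_pos: "x \<in> pos_cone V \<Longrightarrow> f x \<in> pos_cone W"
    and ou_hom_unit: "f (order_unit V) = order_unit W"
  using assms by (auto simp: ou_hom_def linear_maps_def hom_def)

lemma ou_hom_comp:
  assumes "f \<in> ou_hom U V" "g \<in> ou_hom V W"
  shows "g \<circ> f \<in> ou_hom U W"
  by (rule ou_homI) (simp_all add: ou_homD[OF assms(1)] ou_homD[OF assms(2)])

section \<open>Hermitian and positive elements of a single object\<close>

context ou_object
begin

text \<open>The general module laws speak of the unit and zero of
  \<open>ring_of_type_algebra\<close>, which the simplifier turns into the complex numbers 1 and 0;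
  these versions match that normal form.\<close>

lemma complex_smult [simp]:
  assumes "x \<in> carrier V"
  shows "1 \<odot>\<^bsub>V\<^esub> x = x" "0 \<odot>\<^bsub>V\<^esub> x = \<zero>"
  using smult_one[OF assms] smult_l_null[OF assms] by simp_all

lemma pos_cone_carrier: "x \<in> pos_cone V \<Longrightarrow> x \<in> carrier V"
  and pos_cone_star: "x \<in> pos_cone V \<Longrightarrow> star V x = x"
  using pos_cone_hermitian by (auto simp: hermitian_def)

lemma zero_pos: "\<zero> \<in> pos_cone V"
  using pos_cone_proper by auto

lemma hermitian_carrier: "x \<in> hermitian V \<Longrightarrow> x \<in> carrier V"
  by (simp add: hermitian_def)

lemma smult_minus_one: "x \<in> carrier V \<Longrightarrow> (- 1) \<odot>\<^bsub>V\<^esub> x = \<ominus> x"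
  using smult_l_distr[of "-1" 1 x] smult_l_null[of x]
  by (intro M.minus_equality[symmetric]) simp_all

lemma pos_cone_antisym:
  assumes "x \<in> pos_cone V" "\<ominus> x \<in> pos_cone V"
  shows "x = \<zero>"
proof -
  have "x = \<ominus> (\<ominus> x)" using assms by (simp add: pos_cone_carrier)
  then show ?thesis using assms pos_cone_proper by blast
qed

text \<open>Some positive multiple p of the order unit dominates x, and q = p - x. The conclusion is
  a sum rather than a difference, so that additivity of a map applies to it directly.\<close>

lemma hermitian_diff_pos:
  assumes "x \<in> hermitian V"
  obtains p q where "p \<in> pos_cone V" "q \<in> pos_cone V" "x \<oplus> q = p"
proof -
  obtain r :: real where r: "r > 0" "ou_le V x (complex_of_real r \<odot>\<^bsub>V\<^esub> order_unit V)"
    using order_unit_dominates[OF assms] by blast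
  define p where "p = complex_of_real r \<odot>\<^bsub>V\<^esub> order_unit V"
  have p: "p \<in> pos_cone V"
    using r order_unit_pos by (simp add: p_def pos_cone_smult)
  have q: "p \<ominus> x \<in> pos_cone V"
    using r by (simp add: p_def ou_le_def)
  have "x \<oplus> (p \<ominus> x) = p"
    using p assms
    by (metis M.add.inv_closed M.add.m_comm M.add.inv_solve_right M.minus_closed M.minus_eq
        hermitian_carrier pos_cone_carrier)
  then show thesis using p q that by blast
qed

lemma hermitian_parts:
  assumes "x \<in> carrier V"
  shows "\<exists>a \<in> hermitian V. \<exists>b \<in> hermitian V. x = a \<oplus> \<i> \<odot>\<^bsub>V\<^esub> b"
proof -
  let ?a = "(1/2) \<odot>\<^bsub>V\<^esub> (x \<oplus> star V x)"
  let ?b = "(- \<i>/2) \<odot>\<^bsub>V\<^esub> (x \<oplus> (-1) \<odot>\<^bsub>V\<^esub> star V x)"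
  have s: "star V x \<in> carrier V" using assms by (rule star_closed)
  have c: "?a \<in> carrier V" "?b \<in> carrier V" using assms s by simp_all
  have "star V ?a = ?a"
    using assms s by (simp add: star_smult star_add star_star M.add.m_comm)
  moreover have "star V ?b = (\<i>/2) \<odot>\<^bsub>V\<^esub> (star V x \<oplus> (-1) \<odot>\<^bsub>V\<^esub> x)"
    using assms s by (simp add: star_smult star_add star_star)
  \<comment> \<open>Conjugation has changed the sign of the scalar, and the involution has exchanged
    x and x*; the two sign changes cancel.\<close>
  moreover have "\<dots> = ?b"
    using assms s smult_assoc1[of "\<i>/2" "-1" x] smult_assoc1[of "-\<i>/2" "-1" "star V x"]
    by (simp add: smult_r_distr M.add.m_comm)
  moreover have "x = ?a \<oplus> \<i> \<odot>\<^bsub>V\<^esub> ?b"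
  proof -
    have "?a \<oplus> \<i> \<odot>\<^bsub>V\<^esub> ?b = ((1/2) \<odot>\<^bsub>V\<^esub> x \<oplus> (1/2) \<odot>\<^bsub>V\<^esub> star V x) \<oplus> ((1/2) \<odot>\<^bsub>V\<^esub> x \<oplus> (-1/2) \<odot>\<^bsub>V\<^esub> star V x)"
      using assms s smult_assoc1[of \<i> "-\<i>/2"] smult_assoc1[of "1/2" "-1" "star V x"]
      by (simp add: smult_r_distr smult_assoc1[symmetric])
    \<comment> \<open>Regrouped this way, the halves of x add up to x and the halves of x*
      cancel.\<close>
    also have "\<dots> = ((1/2) \<odot>\<^bsub>V\<^esub> x \<oplus> (1/2) \<odot>\<^bsub>V\<^esub> x) \<oplus> ((1/2) \<odot>\<^bsub>V\<^esub> star V x \<oplus> (-1/2) \<odot>\<^bsub>V\<^esub> star V x)"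
      using assms s by (simp add: M.add.m_ac)
    also have "\<dots> = x"
      using assms s smult_l_distr[of "1/2" "1/2" x] smult_l_distr[of "1/2" "-1/2" "star V x"]
      by simp
    finally show ?thesis ..
  qed
  ultimately show ?thesis using c unfolding hermitian_def by (metis (mono_tags) mem_Collect_eq)
qed

end

section \<open>Unital positive maps preserve the involution\<close>

locale ou_pair = V: ou_object V + W: ou_object W
  for V :: "'a ou_space" and W :: "'b ou_space"
begin

lemma hom_zero:
  assumes "f \<in> ou_hom V W"
  shows "f \<zero>\<^bsub>V\<^esub> = \<zero>\<^bsub>W\<^esub>"
  using ou_hom_smult[OF assms, of "\<zero>\<^bsub>V\<^esub>" 0] ou_hom_closed[OF assms, of "\<zero>\<^bsub>V\<^esub>"] by simp

lemma hom_minus: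
  assumes "f \<in> ou_hom V W" "x \<in> carrier V"
  shows "f (\<ominus>\<^bsub>V\<^esub> x) = \<ominus>\<^bsub>W\<^esub> f x"
  using ou_hom_smult[OF assms, of "-1"] ou_hom_closed[OF assms] assms
  by (simp add: V.smult_minus_one W.smult_minus_one)

text \<open>With x + q = p for positive p and q, the images of p and q are positive, hence fixed by
  \<open>star\<close>. Applying \<open>star\<close> to f x + f q = f p and cancelling f q shows that
  f x is fixed as well.\<close>

lemma hom_hermitian:
  assumes "f \<in> ou_hom V W" "x \<in> hermitian V"
  shows "f x \<in> hermitian W"
proof -
  obtain p q where pq: "p \<in> pos_cone V" "q \<in> pos_cone V" "x \<oplus>\<^bsub>V\<^esub> q = p"
    using assms(2) by (rule V.hermitian_diff_pos)
  note f = ou_homD[OF assms(1)]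
  have x: "f x \<in> carrier W" using f(1) V.hermitian_carrier assms(2) by blast
  have P: "f p \<in> pos_cone W" "f q \<in> pos_cone W" using f(4) pq by auto
  note c = W.pos_cone_carrier[OF P(1)] W.pos_cone_carrier[OF P(2)]
  have e: "f x \<oplus>\<^bsub>W\<^esub> f q = f p"
    using f(2)[of x q] pq V.hermitian_carrier assms(2) V.pos_cone_carrier by auto
  have "star W (f x) \<oplus>\<^bsub>W\<^esub> f q = star W (f x \<oplus>\<^bsub>W\<^esub> f q)"
    using x P c by (simp add: W.star_add W.pos_cone_star)
  also have "\<dots> = f x \<oplus>\<^bsub>W\<^esub> f q" using e P by (simp add: W.pos_cone_star)
  finally have "star W (f x) = f x" using x c W.star_closed by simp
  then show ?thesis using x by (simp add: hermitian_def)
qed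

text \<open>For x = a + ib with a, b hermitian, x* = a - ib. Since f a and f b are hermitian again,
  both sides equal f a - i f b.\<close>

lemma hom_star:
  assumes f: "f \<in> ou_hom V W" and x: "x \<in> carrier V"
  shows "f (star V x) = star W (f x)"
proof -
  obtain a b where ab: "a \<in> hermitian V" "b \<in> hermitian V" "x = a \<oplus>\<^bsub>V\<^esub> \<i> \<odot>\<^bsub>V\<^esub> b"
    using V.hermitian_parts[OF x] by blast
  note h = hom_hermitian[OF f ab(1)] hom_hermitian[OF f ab(2)]
  have "star V x = a \<oplus>\<^bsub>V\<^esub> (-\<i>) \<odot>\<^bsub>V\<^esub> b"
    using ab by (simp add: V.star_add V.star_smult hermitian_def)
  moreover have "star W (f x) = f a \<oplus>\<^bsub>W\<^esub> (-\<i>) \<odot>\<^bsub>W\<^esub> f b"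
    using ab h
    by (simp add: ou_homD[OF f] W.star_add W.star_smult hermitian_def)
  ultimately show ?thesis using ab by (simp add: ou_homD[OF f] hermitian_def)
qed

end

section \<open>The inductive system and its connecting maps\<close>

locale ou_system =
  fixes V :: "nat \<Rightarrow> 'a ou_space" and \<phi> :: "nat \<Rightarrow> 'a \<Rightarrow> 'a"
  assumes system: "ou_inductive_system V \<phi>"
begin

sublocale V: ou_object "V k" for k
  using system by (simp add: ou_inductive_system_def)

lemma pair: "ou_pair (V k) (V l)" ..

lemma phi_hom: "\<phi> k \<in> ou_hom (V k) (V (Suc k))"
  using system by (simp add: ou_inductive_system_def)

abbreviation "con \<equiv> connecting \<phi>"
abbreviation "Seq \<equiv> coherent_seqs V \<phi>"
abbreviation "Null \<equiv> null_seqs V \<phi>"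
abbreviation "L \<equiv> limit_map V \<phi>"
abbreviation "LimV \<equiv> limit_space V \<phi>"

lemma con_refl [simp]: "con k k x = x"
  by (simp add: connecting_def)

lemma con_Suc: "k \<le> l \<Longrightarrow> con k (Suc l) x = \<phi> l (con k l x)"
  by (simp add: connecting_def)

lemma con_trans:
  assumes "k \<le> l" "l \<le> m"
  shows "con l m (con k l x) = con k m x"
  using assms(2) assms(1) by (induction m rule: dec_induct) (simp_all add: con_Suc)

lemma con_hom:
  assumes "k \<le> l"
  shows "con k l \<in> ou_hom (V k) (V l)"
  using assms
proof (induction l rule: dec_induct)
  case base
  show ?case by (rule ou_homI) simp_all
next
  case (step l)
  have "con k (Suc l) = \<phi> l \<circ> con k l" using step by (simp add: fun_eq_iff con_Suc)
  then show ?case by (metis ou_hom_comp step.IH phi_hom)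
qed

lemmas con_closed = ou_hom_closed[OF con_hom]
  and con_add = ou_hom_add[OF con_hom]
  and con_smult = ou_hom_smult[OF con_hom]
  and con_pos = ou_hom_pos[OF con_hom]
  and con_unit = ou_hom_unit[OF con_hom]
  and con_zero = ou_pair.hom_zero[OF pair con_hom]
  and con_minus = ou_pair.hom_minus[OF pair con_hom]
  and con_star = ou_pair.hom_star[OF pair con_hom]

text \<open>Induction on the number of steps. The family f is arbitrary, not necessarily made of
  morphisms, so that it can also be a canonical map composed with \<open>star\<close>.\<close>

lemma con_compat:
  assumes "\<And>k x. x \<in> carrier (V k) \<Longrightarrow> f (Suc k) (\<phi> k x) = f k x"
    and "k \<le> l" "x \<in> carrier (V k)"
  shows "f l (con k l x) = f k x"
  using assms(2) by (induction l rule: dec_induct) (simp_all add: con_Suc assms(1,3) con_closed)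

section \<open>Coherent sequences modulo null sequences\<close>

lemma Seq_simps:
  "x \<in> carrier Seq \<longleftrightarrow> (\<forall>k. x k \<in> carrier (V k)) \<and> (\<exists>m. \<forall>k\<ge>m. \<phi> k (x k) = x (Suc k))"
  "\<zero>\<^bsub>Seq\<^esub> = (\<lambda>k. \<zero>\<^bsub>V k\<^esub>)"
  "x \<oplus>\<^bsub>Seq\<^esub> y = (\<lambda>k. x k \<oplus>\<^bsub>V k\<^esub> y k)"
  "c \<odot>\<^bsub>Seq\<^esub> x = (\<lambda>k. c \<odot>\<^bsub>V k\<^esub> x k)"
  by (simp_all add: coherent_seqs_def)

text \<open>Beyond the larger of the two thresholds both sequences are coherent. This gives closure
  under all pointwise operations at once; unary operations take x = y.\<close>

lemma Seq_pointwise: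
  assumes "x \<in> carrier Seq" "y \<in> carrier Seq"
    and "\<And>k. z k \<in> carrier (V k)"
    and "\<And>k. \<phi> k (x k) = x (Suc k) \<Longrightarrow> \<phi> k (y k) = y (Suc k) \<Longrightarrow> \<phi> k (z k) = z (Suc k)"
  shows "z \<in> carrier Seq"
proof -
  obtain m n where "\<forall>k\<ge>m. \<phi> k (x k) = x (Suc k)" "\<forall>k\<ge>n. \<phi> k (y k) = y (Suc k)"
    using assms(1,2) by (auto simp: Seq_simps)
  then have "\<forall>k\<ge>max m n. \<phi> k (z k) = z (Suc k)" using assms(4) by simp
  then show ?thesis using assms(3) unfolding Seq_simps by blast
qed

lemma Seq_add_closed: "x \<in> carrier Seq \<Longrightarrow> y \<in> carrier Seq \<Longrightarrow> x \<oplus>\<^bsub>Seq\<^esub> y \<in> carrier Seq"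
  by (rule Seq_pointwise[of x y]) (auto simp: Seq_simps ou_homD[OF phi_hom])

lemma Seq_minus_closed: "x \<in> carrier Seq \<Longrightarrow> (\<lambda>k. \<ominus>\<^bsub>V k\<^esub> x k) \<in> carrier Seq"
  by (rule Seq_pointwise[of x x]) (auto simp: Seq_simps ou_pair.hom_minus[OF pair phi_hom])

lemma Seq_smult_closed: "x \<in> carrier Seq \<Longrightarrow> c \<odot>\<^bsub>Seq\<^esub> x \<in> carrier Seq"
  by (rule Seq_pointwise[of x x]) (auto simp: Seq_simps ou_homD[OF phi_hom])

lemma Seq_abelian_group: "abelian_group Seq"
proof (rule abelian_groupI)
  fix x assume x: "x \<in> carrier Seq"
  then show "\<exists>y\<in>carrier Seq. y \<oplus>\<^bsub>Seq\<^esub> x = \<zero>\<^bsub>Seq\<^esub>"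
    by (intro bexI[OF _ Seq_minus_closed[OF x]]) (auto simp: Seq_simps V.M.l_neg)
next
  show "\<zero>\<^bsub>Seq\<^esub> \<in> carrier Seq"
    by (auto simp: Seq_simps ou_pair.hom_zero[OF pair phi_hom])
qed (auto simp: Seq_add_closed, auto simp: Seq_simps V.M.add.m_assoc intro!: ext V.M.add.m_comm)

sublocale Seq: abelian_group Seq
  by (rule Seq_abelian_group)

lemma Seq_minus:
  assumes "x \<in> carrier Seq"
  shows "\<ominus>\<^bsub>Seq\<^esub> x = (\<lambda>k. \<ominus>\<^bsub>V k\<^esub> x k)"
  using assms Seq_minus_closed[OF assms]
  by (intro Seq.minus_equality) (auto simp: Seq_simps V.M.l_neg)

lemma Null_iff: "x \<in> Null \<longleftrightarrow> x \<in> carrier Seq \<and> (\<exists>m. \<forall>k\<ge>m. x k = \<zero>\<^bsub>V k\<^esub>)"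
  by (simp add: null_seqs_def)

lemma Null_additive: "additive_subgroup Null Seq"
proof (rule additive_subgroupI, rule Seq.add.subgroupI)
  show "Null \<subseteq> carrier Seq" by (auto simp: Null_iff)
  have "\<zero>\<^bsub>Seq\<^esub> \<in> Null" using Seq.zero_closed by (simp add: Null_iff Seq_simps(2))
  then show "Null \<noteq> {}" by blast
next
  fix x assume "x \<in> Null"
  then obtain m where x: "x \<in> carrier Seq" "\<forall>k\<ge>m. x k = \<zero>\<^bsub>V k\<^esub>" by (auto simp: Null_iff)
  have "\<forall>k\<ge>m. (\<ominus>\<^bsub>Seq\<^esub> x) k = \<zero>\<^bsub>V k\<^esub>" using x by (simp add: Seq_minus)
  then show "\<ominus>\<^bsub>Seq\<^esub> x \<in> Null" using Seq.a_inv_closed[OF x(1)] unfolding Null_iff by blast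
next
  fix x y assume xy: "x \<in> Null" "y \<in> Null"
  then obtain m n where "\<forall>k\<ge>m. x k = \<zero>\<^bsub>V k\<^esub>" "\<forall>k\<ge>n. y k = \<zero>\<^bsub>V k\<^esub>"
    by (auto simp: Null_iff)
  then have "\<forall>k\<ge>max m n. (x \<oplus>\<^bsub>Seq\<^esub> y) k = \<zero>\<^bsub>V k\<^esub>" by (simp add: Seq_simps)
  then show "x \<oplus>\<^bsub>Seq\<^esub> y \<in> Null"
    using xy by (auto simp: Null_iff simp del: max.bounded_iff)
qed

sublocale Null: abelian_subgroup Null Seq
  by (rule abelian_subgroupI3[OF Null_additive Seq_abelian_group])

abbreviation "coset \<equiv> a_r_coset Seq Null"

text \<open>Membership means that y - x is a null sequence, and its k-th term vanishes exactly when
  the k-th terms agree. Cosets are thus the classes of eventual equality.\<close>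

lemma coset_mem_iff:
  assumes x: "x \<in> carrier Seq"
  shows "y \<in> coset x \<longleftrightarrow> y \<in> carrier Seq \<and> (\<exists>m. \<forall>k\<ge>m. y k = x k)"
proof (cases "y \<in> carrier Seq")
  case True
  have "(y \<oplus>\<^bsub>Seq\<^esub> \<ominus>\<^bsub>Seq\<^esub> x) k = \<zero>\<^bsub>V k\<^esub> \<longleftrightarrow> y k = x k" for k
    using x True by (simp add: Seq_minus) (simp add: Seq_simps V.M.add.inv_solve_right')
  then show ?thesis
    using x True by (simp add: Null.a_rcos_module[OF x True] Null_iff)
qed (use Null.a_elemrcos_carrier[OF x] in blast)

lemma coset_eq_iff:
  assumes x: "x \<in> carrier Seq" and y: "y \<in> carrier Seq"
  shows "coset x = coset y \<longleftrightarrow> (\<exists>m. \<forall>k\<ge>m. x k = y k)"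
  using Null.a_rcos_self[OF x] coset_mem_iff[OF y, of x] x
    Seq.a_repr_independence[OF _ y Null.a_subgroup, of x] by metis

section \<open>The canonical maps into the limit and equality of their values\<close>

definition tail :: "nat \<Rightarrow> 'a \<Rightarrow> nat \<Rightarrow> 'a" where
  "tail k x = (\<lambda>i. if i < k then \<zero>\<^bsub>V i\<^esub> else con k i x)"

lemma L_coset: "L k x = coset (tail k x)"
  by (simp add: limit_map_def tail_def)

lemma tail_coherent: "x \<in> carrier (V k) \<Longrightarrow> tail k x \<in> carrier Seq"
  \<comment> \<open>Coherence is claimed only from index k on: just before k the sequence jumps from
    zero to x.\<close>
  by (auto simp: Seq_simps tail_def con_closed con_Suc intro!: exI[of _ k])

text \<open>Equal cosets have eventually equal tails, which can be compared at one late index.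
  Conversely, equality at one level m is carried by the connecting maps to every later level. From
  here on, equality in the limit can be tested inside a single \<open>V m\<close>.\<close>

lemma L_eq_iff:
  assumes "x \<in> carrier (V k)" "y \<in> carrier (V l)"
  shows "L k x = L l y \<longleftrightarrow> (\<exists>m. m \<ge> k \<and> m \<ge> l \<and> con k m x = con l m y)"
proof
  assume "L k x = L l y"
  then obtain m where m: "\<forall>i\<ge>m. tail k x i = tail l y i"
    using assms by (auto simp: L_coset coset_eq_iff tail_coherent)
  \<comment> \<open>The index m + k + l is at least m, k and l: the tails agree there, and neither
    is in its initial run of zeros.\<close>
  have "con k (m + k + l) x = con l (m + k + l) y"
    using m[rule_format, of "m + k + l"] by (simp add: tail_def)
  then show "\<exists>m. m \<ge> k \<and> m \<ge> l \<and> con k m x = con l m y"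
    by (intro exI[of _ "m + k + l"]) auto
next
  assume "\<exists>m. m \<ge> k \<and> m \<ge> l \<and> con k m x = con l m y"
  then obtain m where m: "m \<ge> k" "m \<ge> l" "con k m x = con l m y" by blast
  then have "con k i x = con l i y" if "i \<ge> m" for i
    using that con_trans[of k m i x] con_trans[of l m i y] by simp
  then show "L k x = L l y"
    unfolding L_coset coset_eq_iff[OF tail_coherent[OF assms(1)] tail_coherent[OF assms(2)]]
    using m by (intro exI[of _ m]) (simp add: tail_def)
qed

lemma L_con:
  assumes "k \<le> l" "x \<in> carrier (V k)"
  shows "L l (con k l x) = L k x"
  using assms by (auto simp: L_eq_iff con_closed)

section \<open>Operations and representatives in the limit\<close>

lemma Lim_simps:
  "carrier LimV = a_rcosets\<^bsub>Seq\<^esub> Null"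
  "\<zero>\<^bsub>LimV\<^esub> = Null"
  "S \<oplus>\<^bsub>LimV\<^esub> T = S <+>\<^bsub>Seq\<^esub> T"
  "c \<odot>\<^bsub>LimV\<^esub> S = (\<Union>x\<in>S. coset (c \<odot>\<^bsub>Seq\<^esub> x))"
  "order_unit LimV = L 0 (order_unit (V 0))"
  by (simp_all add: limit_space_def)

lemma L_closed: "x \<in> carrier (V k) \<Longrightarrow> L k x \<in> carrier LimV"
  by (simp add: Lim_simps L_coset Seq.a_rcosetsI Null.a_subset tail_coherent)

text \<open>The level k is free, so that zero can be represented at the same level as the other
  elements of an argument.\<close>

lemma L_zero: "\<zero>\<^bsub>LimV\<^esub> = L k \<zero>\<^bsub>V k\<^esub>"
proof -
  have "tail k \<zero>\<^bsub>V k\<^esub> \<in> Null"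
    by (auto simp: Null_iff tail_coherent) (auto simp: tail_def con_zero)
  then show ?thesis by (simp add: Lim_simps L_coset Null.a_rcos_const)
qed

lemma L_add:
  assumes "x \<in> carrier (V k)" "y \<in> carrier (V k)"
  shows "L k x \<oplus>\<^bsub>LimV\<^esub> L k y = L k (x \<oplus>\<^bsub>V k\<^esub> y)"
proof -
  have "tail k x \<oplus>\<^bsub>Seq\<^esub> tail k y = tail k (x \<oplus>\<^bsub>V k\<^esub> y)"
    using assms by (auto simp: Seq_simps tail_def con_add)
  then show ?thesis
    using assms by (simp add: Lim_simps L_coset Null.a_rcos_sum tail_coherent)
qed

text \<open>Representatives of one coset agree eventually, and so do their multiples by c. All
  members of the union that defines the scalar multiple are therefore the same coset.\<close>

lemma L_smult:
  assumes "x \<in> carrier (V k)"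
  shows "c \<odot>\<^bsub>LimV\<^esub> L k x = L k (c \<odot>\<^bsub>V k\<^esub> x)"
proof -
  note t = tail_coherent[OF assms]
  have e: "c \<odot>\<^bsub>Seq\<^esub> tail k x = tail k (c \<odot>\<^bsub>V k\<^esub> x)"
    using assms by (auto simp: Seq_simps tail_def con_smult)
  have "coset (c \<odot>\<^bsub>Seq\<^esub> y) = coset (c \<odot>\<^bsub>Seq\<^esub> tail k x)" if "y \<in> coset (tail k x)" for y
  proof -
    have "y \<in> carrier Seq \<and> (\<exists>m. \<forall>i\<ge>m. y i = tail k x i)"
      using that coset_mem_iff[OF t] by simp
    then obtain m where "y \<in> carrier Seq" "\<forall>i\<ge>m. y i = tail k x i" by blast
    then have "\<forall>i\<ge>m. (c \<odot>\<^bsub>Seq\<^esub> y) i = (c \<odot>\<^bsub>Seq\<^esub> tail k x) i"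
      by (simp add: Seq_simps(4))
    then show ?thesis
      unfolding coset_eq_iff[OF Seq_smult_closed[OF \<open>y \<in> carrier Seq\<close>] Seq_smult_closed[OF t]]
      by blast
  qed
  then show ?thesis
    \<comment> \<open>The coset contains its representative, so the union of equal sets is not
      empty.\<close>
    using Null.a_rcos_self[OF t] by (auto simp: Lim_simps L_coset e)
qed

text \<open>Unitality of the connecting maps makes the choice of level 0 in
  \<open>limit_space\<close> immaterial.\<close>

lemma L_unit: "order_unit LimV = L k (order_unit (V k))"
  using L_con[of 0 k "order_unit (V 0)"]
  by (simp add: Lim_simps con_unit V.order_unit_pos V.pos_cone_carrier)

text \<open>Beyond its threshold m, a coherent sequence x is the orbit of any of its terms: it
  agrees with the tail of \<open>x l\<close> from index l on. Having representatives at all late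
  levels, not just at one, lets several elements share a level.\<close>

lemma Lim_rep:
  assumes "S \<in> carrier LimV"
  obtains k where "\<And>l. l \<ge> k \<Longrightarrow> \<exists>x \<in> carrier (V l). S = L l x"
proof -
  obtain x where x: "x \<in> carrier Seq" "S = coset x"
    using assms by (auto simp: Lim_simps A_RCOSETS_def')
  then obtain m where m: "\<forall>k\<ge>m. \<phi> k (x k) = x (Suc k)" by (auto simp: Seq_simps)
  have c: "x k \<in> carrier (V k)" for k using x by (simp add: Seq_simps)
  have "con l i (x l) = x i" if "l \<ge> m" "i \<ge> l" for l i
    using that(2,1) by (induction i rule: dec_induct) (simp_all add: con_Suc m)
  then have "S = L l (x l)" if "l \<ge> m" for l
    unfolding x(2) L_coset coset_eq_iff[OF x(1) tail_coherent[OF c]]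
    using that by (intro exI[of _ l]) (simp add: tail_def)
  then show thesis using that c by blast
qed

lemma Lim_rep1:
  assumes "S \<in> carrier LimV"
  obtains k x where "x \<in> carrier (V k)" "S = L k x"
  using Lim_rep[OF assms] by blast

lemma Lim_rep2:
  assumes "S \<in> carrier LimV" "T \<in> carrier LimV"
  obtains k x y where "x \<in> carrier (V k)" "S = L k x" "y \<in> carrier (V k)" "T = L k y"
proof -
  obtain k where k: "\<And>i. i \<ge> k \<Longrightarrow> \<exists>x \<in> carrier (V i). S = L i x"
    using Lim_rep[OF assms(1)] by blast
  obtain l where l: "\<And>i. i \<ge> l \<Longrightarrow> \<exists>x \<in> carrier (V i). T = L i x"
    using Lim_rep[OF assms(2)] by blast
  show thesis
    using k[OF max.cobounded1[of k l]] l[OF max.cobounded2[of l k]] that by blast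
qed

lemma Lim_rep3:
  assumes "S \<in> carrier LimV" "T \<in> carrier LimV" "U \<in> carrier LimV"
  obtains k x y z where "x \<in> carrier (V k)" "S = L k x" "y \<in> carrier (V k)" "T = L k y"
    "z \<in> carrier (V k)" "U = L k z"
proof -
  obtain k where k: "\<And>i. i \<ge> k \<Longrightarrow> \<exists>x \<in> carrier (V i). S = L i x"
    using Lim_rep[OF assms(1)] by blast
  obtain l x y where l: "x \<in> carrier (V l)" "T = L l x" "y \<in> carrier (V l)" "U = L l y"
    using Lim_rep2[OF assms(2,3)] by blast
  obtain z where "z \<in> carrier (V (max k l))" "S = L (max k l) z"
    using k[of "max k l"] by auto
  then show thesis
    using that[of z "max k l" "con l (max k l) x" "con l (max k l) y"] l
    by (simp add: L_con con_closed)
qed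

text \<open>Two representatives of one element become equal at some level m, and compatibility
  identifies both values of f with the value there. This well-definedness serves both the involution
  and the mediating morphism.\<close>

lemma the_limit_value:
  assumes compat: "\<And>k x. x \<in> carrier (V k) \<Longrightarrow> f (Suc k) (\<phi> k x) = f k x"
    and x: "x \<in> carrier (V k)"
  shows "(THE b. \<exists>l. \<exists>y \<in> carrier (V l). L k x = L l y \<and> b = f l y) = f k x"
proof (rule the_equality)
  fix b assume "\<exists>l. \<exists>y \<in> carrier (V l). L k x = L l y \<and> b = f l y"
  then obtain l y m where "y \<in> carrier (V l)" "b = f l y" "m \<ge> k" "m \<ge> l" "con k m x = con l m y"
    using x by (auto simp: L_eq_iff)
  then show "b = f k x"
    using con_compat[of f, OF compat] x by metis
qed (use x in blast)

section \<open>Involution, cone and hermitian elements on representatives\<close>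

lemma L_phi: "x \<in> carrier (V k) \<Longrightarrow> L (Suc k) (\<phi> k x) = L k x"
  using L_con[of k "Suc k" x] by (simp add: con_Suc)

lemma L_star:
  assumes "x \<in> carrier (V k)"
  shows "star LimV (L k x) = L k (star (V k) x)"
proof -
  \<comment> \<open>Compatibility of the family that sends x to the class of x*: the maps of the
    system commute with \<open>star\<close>.\<close>
  have "L (Suc l) (star (V (Suc l)) (\<phi> l y)) = L l (star (V l) y)" if "y \<in> carrier (V l)" for l y
    using L_phi[OF V.star_closed[OF that]] ou_pair.hom_star[OF pair phi_hom that] by simp
  from the_limit_value[of "\<lambda>k x. L k (star (V k) x)", OF this assms]
  show ?thesis by (simp add: limit_space_def)
qed

lemma L_pos: "x \<in> pos_cone (V k) \<Longrightarrow> L k x \<in> pos_cone LimV"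
  using V.pos_cone_carrier by (force simp: limit_space_def)

text \<open>A representative of a positive element need not be positive itself, but its image at
  some level m is. Positivity of the connecting maps preserves this at all later levels.\<close>

lemma pos_cone_rep:
  assumes "S \<in> pos_cone LimV"
  obtains k where "\<And>l. l \<ge> k \<Longrightarrow> \<exists>x \<in> pos_cone (V l). S = L l x"
proof -
  obtain k x m where x: "x \<in> carrier (V k)" "S = L k x" "m \<ge> k" "con k m x \<in> pos_cone (V m)"
    using assms by (auto simp: limit_space_def)
  have "con k l x \<in> pos_cone (V l)" "S = L l (con k l x)" if "l \<ge> m" for l
    using that x con_trans[of k m l x] con_pos[of m l "con k m x"] L_con[of k l x] by auto
  then show thesis using that by blast
qed

lemma pos_cone_rep1:
  assumes "S \<in> pos_cone LimV"
  obtains k x where "x \<in> pos_cone (V k)" "S = L k x"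
  using pos_cone_rep[OF assms] by blast

lemma pos_cone_rep2:
  assumes "S \<in> pos_cone LimV" "T \<in> pos_cone LimV"
  obtains k x y where "x \<in> pos_cone (V k)" "S = L k x" "y \<in> pos_cone (V k)" "T = L k y"
proof -
  obtain k where k: "\<And>i. i \<ge> k \<Longrightarrow> \<exists>x \<in> pos_cone (V i). S = L i x"
    using pos_cone_rep[OF assms(1)] by blast
  obtain l where l: "\<And>i. i \<ge> l \<Longrightarrow> \<exists>x \<in> pos_cone (V i). T = L i x"
    using pos_cone_rep[OF assms(2)] by blast
  show thesis
    using k[OF max.cobounded1[of k l]] l[OF max.cobounded2[of l k]] that by blast
qed

text \<open>The equation S* = S says only that x* and x have the same image at some level m. It is
  the image of x at that level that is hermitian, and it still represents S.\<close>

lemma hermitian_rep: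
  assumes "S \<in> hermitian LimV"
  obtains k x where "x \<in> hermitian (V k)" "S = L k x"
proof -
  obtain k x where x: "x \<in> carrier (V k)" "S = L k x"
    using assms by (auto simp: hermitian_def elim: Lim_rep1)
  then have "L k (star (V k) x) = L k x" using assms by (simp add: hermitian_def L_star)
  then obtain m where m: "m \<ge> k" "con k m (star (V k) x) = con k m x"
    using x V.star_closed by (auto simp: L_eq_iff)
  then have "con k m x \<in> hermitian (V m)"
    using x by (simp add: hermitian_def con_closed con_star)
  then show thesis using that L_con[OF m(1) x(1)] x(2) by metis
qed

section \<open>The limit is an object of OU\<close>

lemma Lim_abelian_group: "abelian_group LimV"
proof (rule abelian_groupI)
  fix S T assume "S \<in> carrier LimV" "T \<in> carrier LimV"
  then obtain k x y where "x \<in> carrier (V k)" "S = L k x" "y \<in> carrier (V k)" "T = L k y"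
    by (rule Lim_rep2)
  then show "S \<oplus>\<^bsub>LimV\<^esub> T \<in> carrier LimV" "S \<oplus>\<^bsub>LimV\<^esub> T = T \<oplus>\<^bsub>LimV\<^esub> S"
    by (simp_all add: L_add L_closed V.M.add.m_comm)
next
  fix S T U assume "S \<in> carrier LimV" "T \<in> carrier LimV" "U \<in> carrier LimV"
  then obtain k x y z where "x \<in> carrier (V k)" "S = L k x" "y \<in> carrier (V k)" "T = L k y"
    "z \<in> carrier (V k)" "U = L k z"
    by (rule Lim_rep3)
  then show "S \<oplus>\<^bsub>LimV\<^esub> T \<oplus>\<^bsub>LimV\<^esub> U = S \<oplus>\<^bsub>LimV\<^esub> (T \<oplus>\<^bsub>LimV\<^esub> U)"
    by (simp add: L_add V.M.add.m_assoc)
next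
  fix S assume "S \<in> carrier LimV"
  then obtain k x where x: "x \<in> carrier (V k)" "S = L k x" by (rule Lim_rep1)
  then show "\<zero>\<^bsub>LimV\<^esub> \<oplus>\<^bsub>LimV\<^esub> S = S" by (simp add: L_zero[of k] L_add)
  have "L k (\<ominus>\<^bsub>V k\<^esub> x) \<oplus>\<^bsub>LimV\<^esub> S = \<zero>\<^bsub>LimV\<^esub>"
    using x by (simp add: L_zero[of k] L_add V.M.l_neg)
  then show "\<exists>T\<in>carrier LimV. T \<oplus>\<^bsub>LimV\<^esub> S = \<zero>\<^bsub>LimV\<^esub>"
    using x L_closed by blast
qed (simp add: L_zero[of 0] L_closed)

sublocale LimV: abelian_group LimV
  by (rule Lim_abelian_group)

lemma L_minus:
  assumes "x \<in> carrier (V k)"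
  shows "\<ominus>\<^bsub>LimV\<^esub> L k x = L k (\<ominus>\<^bsub>V k\<^esub> x)"
  using assms
  by (intro LimV.minus_equality) (simp_all add: L_zero[of k] L_add L_closed V.M.l_neg)

lemma Lim_module: "module (ring_of_type_algebra :: complex ring) LimV"
proof (rule moduleI[OF cring_from_type_algebra Lim_abelian_group])
  fix a b :: complex and S assume "S \<in> carrier LimV"
  then obtain k x where "x \<in> carrier (V k)" "S = L k x" by (rule Lim_rep1)
  then show "a \<odot>\<^bsub>LimV\<^esub> S \<in> carrier LimV"
    "(a \<oplus>\<^bsub>ring_of_type_algebra\<^esub> b) \<odot>\<^bsub>LimV\<^esub> S = a \<odot>\<^bsub>LimV\<^esub> S \<oplus>\<^bsub>LimV\<^esub> b \<odot>\<^bsub>LimV\<^esub> S"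
    "(a \<otimes>\<^bsub>ring_of_type_algebra\<^esub> b) \<odot>\<^bsub>LimV\<^esub> S = a \<odot>\<^bsub>LimV\<^esub> (b \<odot>\<^bsub>LimV\<^esub> S)"
    "\<one>\<^bsub>ring_of_type_algebra\<^esub> \<odot>\<^bsub>LimV\<^esub> S = S"
    \<comment> \<open>Inserted as facts, these laws of \<open>V k\<close> undergo the same rewriting
      of ring operations into complex arithmetic as the goals.\<close>
    using V.smult_l_distr[of a b x k] V.smult_assoc1[of a b x k] V.smult_one[of x k]
    by (simp_all add: L_smult L_closed L_add)
next
  fix a :: complex and S T assume "S \<in> carrier LimV" "T \<in> carrier LimV"
  then obtain k x y where "x \<in> carrier (V k)" "S = L k x" "y \<in> carrier (V k)" "T = L k y"
    by (rule Lim_rep2)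
  then show "a \<odot>\<^bsub>LimV\<^esub> (S \<oplus>\<^bsub>LimV\<^esub> T) = a \<odot>\<^bsub>LimV\<^esub> S \<oplus>\<^bsub>LimV\<^esub> a \<odot>\<^bsub>LimV\<^esub> T"
    by (simp add: L_smult L_add V.smult_r_distr)
qed

lemma Lim_star_vector_space: "star_vector_space LimV"
proof (intro star_vector_space.intro Lim_module star_vector_space_axioms.intro)
  fix S and c :: complex assume "S \<in> carrier LimV"
  then obtain k x where "x \<in> carrier (V k)" "S = L k x" by (rule Lim_rep1)
  then show "star LimV S \<in> carrier LimV" "star LimV (star LimV S) = S"
    "star LimV (c \<odot>\<^bsub>LimV\<^esub> S) = cnj c \<odot>\<^bsub>LimV\<^esub> star LimV S"
    by (simp_all add: L_star L_closed L_smult V.star_closed V.star_star V.star_smult)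
next
  fix S T assume "S \<in> carrier LimV" "T \<in> carrier LimV"
  then obtain k x y where "x \<in> carrier (V k)" "S = L k x" "y \<in> carrier (V k)" "T = L k y"
    by (rule Lim_rep2)
  then show "star LimV (S \<oplus>\<^bsub>LimV\<^esub> T) = star LimV S \<oplus>\<^bsub>LimV\<^esub> star LimV T"
    by (simp add: L_star L_add V.star_closed V.star_add)
qed

text \<open>If positive x and y represent S and -S, then the images of x and -y coincide at some
  level m. There the image of x and its negative are both positive, so properness of the cone of
  \<open>V m\<close> makes it zero.\<close>

lemma Lim_pos_proper: "pos_cone LimV \<inter> (\<lambda>S. \<ominus>\<^bsub>LimV\<^esub> S) ` pos_cone LimV = {\<zero>\<^bsub>LimV\<^esub>}"
proof (intro equalityI subsetI)
  fix S assume "S \<in> pos_cone LimV \<inter> (\<lambda>S. \<ominus>\<^bsub>LimV\<^esub> S) ` pos_cone LimV"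
  then obtain T where ST: "S \<in> pos_cone LimV" "T \<in> pos_cone LimV" and S: "S = \<ominus>\<^bsub>LimV\<^esub> T"
    by blast
  from ST obtain k x y where xy: "x \<in> pos_cone (V k)" "S = L k x" "y \<in> pos_cone (V k)" "T = L k y"
    by (rule pos_cone_rep2)
  note c = V.pos_cone_carrier[OF xy(1)] V.pos_cone_carrier[OF xy(3)]
  have "L k x = L k (\<ominus>\<^bsub>V k\<^esub> y)" using S xy c by (simp add: L_minus)
  then obtain m where m: "m \<ge> k" "con k m x = con k m (\<ominus>\<^bsub>V k\<^esub> y)"
    using c by (auto simp: L_eq_iff)
  then have "\<ominus>\<^bsub>V m\<^esub> con k m x = con k m y"
    using c by (simp add: con_minus con_closed)
  then have "con k m x = \<zero>\<^bsub>V m\<^esub>"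
    using con_pos[OF m(1) xy(1)] con_pos[OF m(1) xy(3)] by (intro V.pos_cone_antisym) simp_all
  then show "S \<in> {\<zero>\<^bsub>LimV\<^esub>}" using L_con[OF m(1) c(1)] xy by (simp add: L_zero[of m])
next
  have "\<zero>\<^bsub>LimV\<^esub> \<in> pos_cone LimV" using L_pos[OF V.zero_pos] by (simp add: L_zero[of 0])
  moreover have "\<zero>\<^bsub>LimV\<^esub> = \<ominus>\<^bsub>LimV\<^esub> \<zero>\<^bsub>LimV\<^esub>"
    by (intro LimV.minus_equality[symmetric]) simp_all
  ultimately show "S \<in> pos_cone LimV \<inter> (\<lambda>S. \<ominus>\<^bsub>LimV\<^esub> S) ` pos_cone LimV"
    if "S \<in> {\<zero>\<^bsub>LimV\<^esub>}" for S
    using that by blast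
qed

lemma Lim_ou_object: "ou_object LimV"
proof (intro ou_object.intro ordered_star_vector_space.intro Lim_star_vector_space
    ordered_star_vector_space_axioms.intro ou_object_axioms.intro Lim_pos_proper)
  show "pos_cone LimV \<subseteq> hermitian LimV"
  proof
    fix S assume "S \<in> pos_cone LimV"
    then obtain k x where "x \<in> pos_cone (V k)" "S = L k x" by (rule pos_cone_rep1)
    then show "S \<in> hermitian LimV"
      using V.pos_cone_carrier[of x k] V.pos_cone_star[of x k]
      by (simp add: hermitian_def L_closed L_star)
  qed
next
  fix S T assume "S \<in> pos_cone LimV" "T \<in> pos_cone LimV"
  then obtain k x y where "x \<in> pos_cone (V k)" "S = L k x" "y \<in> pos_cone (V k)" "T = L k y"
    by (rule pos_cone_rep2)
  then show "S \<oplus>\<^bsub>LimV\<^esub> T \<in> pos_cone LimV"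
    by (simp add: L_add L_pos V.pos_cone_add V.pos_cone_carrier)
next
  fix S and r :: real assume "S \<in> pos_cone LimV" "r \<ge> 0"
  from this(1) obtain k x where "x \<in> pos_cone (V k)" "S = L k x" by (rule pos_cone_rep1)
  then show "complex_of_real r \<odot>\<^bsub>LimV\<^esub> S \<in> pos_cone LimV"
    using \<open>r \<ge> 0\<close> by (simp add: L_smult L_pos V.pos_cone_smult V.pos_cone_carrier)
next
  show "order_unit LimV \<in> pos_cone LimV"
    by (simp add: L_unit[of 0] L_pos V.order_unit_pos)
next
  fix S assume "S \<in> hermitian LimV"
  then obtain k x where x: "x \<in> hermitian (V k)" "S = L k x" by (rule hermitian_rep)
  then obtain r :: real where r: "r > 0"
    "complex_of_real r \<odot>\<^bsub>V k\<^esub> order_unit (V k) \<ominus>\<^bsub>V k\<^esub> x \<in> pos_cone (V k)"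
    using V.order_unit_dominates by (auto simp: ou_le_def)
  \<comment> \<open>The bound r found at level k also works in the limit: the class of the positive
    element r e - x is r times the limit unit minus S.\<close>
  then have "ou_le LimV S (complex_of_real r \<odot>\<^bsub>LimV\<^esub> order_unit LimV)"
    using x V.hermitian_carrier[OF x(1)] L_pos[OF r(2)]
    by (simp add: ou_le_def L_unit[of k] a_minus_def L_smult L_minus L_add
        V.order_unit_pos V.pos_cone_carrier)
  then show "\<exists>r>0. ou_le LimV S (complex_of_real r \<odot>\<^bsub>LimV\<^esub> order_unit LimV)"
    using r by blast
qed

section \<open>The universal property\<close>

lemma L_hom: "L k \<in> ou_hom (V k) LimV"
  by (rule ou_homI) (simp_all add: L_closed L_add L_smult L_pos L_unit[of k])

lemma Lim_universal:
  assumes \<beta>: "\<And>k. \<beta> k \<in> ou_hom (V k) B"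
    and compat: "\<And>k x. x \<in> carrier (V k) \<Longrightarrow> \<beta> (Suc k) (\<phi> k x) = \<beta> k x"
  shows "\<exists>!\<mu>. \<mu> \<in> ou_hom LimV B \<and> \<mu> \<in> extensional (carrier LimV) \<and>
    (\<forall>k. \<forall>x \<in> carrier (V k). \<mu> (L k x) = \<beta> k x)"
proof (rule ex_ex1I)
  \<comment> \<open>The value at S is read off from any representative; the restriction makes the
    map extensional on the carrier.\<close>
  define \<mu> where "\<mu> =
    restrict (\<lambda>S. THE b. \<exists>l. \<exists>y \<in> carrier (V l). S = L l y \<and> b = \<beta> l y) (carrier LimV)"
  have \<mu>: "\<mu> (L k x) = \<beta> k x" if "x \<in> carrier (V k)" for k x
    using that the_limit_value[of \<beta>, OF compat that] by (simp add: \<mu>_def L_closed)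
  note \<beta>D = ou_homD[OF \<beta>]
  have "\<mu> \<in> ou_hom LimV B"
  proof (rule ou_homI)
    fix S and c :: complex assume "S \<in> carrier LimV"
    then obtain k x where "x \<in> carrier (V k)" "S = L k x" by (rule Lim_rep1)
    then show "\<mu> S \<in> carrier B" "\<mu> (c \<odot>\<^bsub>LimV\<^esub> S) = c \<odot>\<^bsub>B\<^esub> \<mu> S"
      by (simp_all add: \<mu> \<beta>D L_smult)
  next
    fix S T assume "S \<in> carrier LimV" "T \<in> carrier LimV"
    then obtain k x y where "x \<in> carrier (V k)" "S = L k x" "y \<in> carrier (V k)" "T = L k y"
      by (rule Lim_rep2)
    then show "\<mu> (S \<oplus>\<^bsub>LimV\<^esub> T) = \<mu> S \<oplus>\<^bsub>B\<^esub> \<mu> T" by (simp add: \<mu> \<beta>D L_add)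
  next
    \<comment> \<open>The representative must itself be positive for positivity of
      \<open>\<beta> k\<close> to apply, hence \<open>pos_cone_rep1\<close> instead of
      \<open>Lim_rep1\<close>.\<close>
    fix S assume "S \<in> pos_cone LimV"
    then obtain k x where "x \<in> pos_cone (V k)" "S = L k x" by (rule pos_cone_rep1)
    then show "\<mu> S \<in> pos_cone B" by (simp add: \<mu> \<beta>D V.pos_cone_carrier)
  next
    show "\<mu> (order_unit LimV) = order_unit B"
      by (simp add: L_unit[of 0] \<mu> \<beta>D V.order_unit_pos V.pos_cone_carrier)
  qed
  moreover have "\<mu> \<in> extensional (carrier LimV)" by (simp add: \<mu>_def)
  ultimately show "\<exists>\<mu>. \<mu> \<in> ou_hom LimV B \<and> \<mu> \<in> extensional (carrier LimV) \<and>
    (\<forall>k. \<forall>x \<in> carrier (V k). \<mu> (L k x) = \<beta> k x)"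
    using \<mu> by blast
next
  fix \<mu> \<nu>
  assume \<mu>: "\<mu> \<in> ou_hom LimV B \<and> \<mu> \<in> extensional (carrier LimV) \<and>
      (\<forall>k. \<forall>x \<in> carrier (V k). \<mu> (L k x) = \<beta> k x)"
    and \<nu>: "\<nu> \<in> ou_hom LimV B \<and> \<nu> \<in> extensional (carrier LimV) \<and>
      (\<forall>k. \<forall>x \<in> carrier (V k). \<nu> (L k x) = \<beta> k x)"
  show "\<mu> = \<nu>"
  \<comment> \<open>The images of the maps \<open>L k\<close> exhaust the carrier, so the prescribed
    values determine the map there; off the carrier extensionality fixes it.\<close>
  proof (rule extensionalityI)
    show "\<mu> \<in> extensional (carrier LimV)" "\<nu> \<in> extensional (carrier LimV)"
      using \<mu> \<nu> by blast+
  next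
    fix S assume "S \<in> carrier LimV"
    then obtain k x where "x \<in> carrier (V k)" "S = L k x" by (rule Lim_rep1)
    then show "\<mu> S = \<nu> S" using \<mu> \<nu> by simp
  qed
qed

end

theorem theorem3p5:
  fixes V :: "nat \<Rightarrow> 'a ou_space" and \<phi> :: "nat \<Rightarrow> 'a \<Rightarrow> 'a"
  assumes "ou_inductive_system V \<phi>"
  shows "ou_inductive_limit TYPE('c) V \<phi> (limit_space V \<phi>) (limit_map V \<phi>)"
proof -
  interpret ou_system V \<phi> by (rule ou_system.intro[OF assms])
  show ?thesis
    unfolding ou_inductive_limit_def
    by (intro conjI allI impI ballI Lim_ou_object L_hom L_phi Lim_universal) blast+
qed

end
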